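(* Let $\mathcal{X}$ be a separable Banach space, let $K\in L(\mathcal{X})$ have closed range, let $\{m_n\}$ be an increasing sequence of positive integers, and let $(\{x_n\},\{h_{n,i}\}_{n\in\mathbb{N},\,1\le i\le m_n})$ be an approximative $K$-atomic decomposition for $\mathcal{X}$ with respect to a BK-space $\mathcal{X}_d$, with bounds $A$ and $B$. Let $T\in L(\mathcal{X})$ with $T\neq 0$. Then $(\{Tx_n\},\{h_{n,i}\}_{n\in\mathbb{N},\,1\le i\le m_n})$ is an approximative $TK$-atomic decomposition for $\mathcal{X}$ with respect to $\mathcal{X}_d$ with bounds $\frac{A}{\|T\|}$ and $B$.
   Context: Scalars are $\mathbb{R}$ or $\mathbb{C}$. $L(\mathcal{X})$ is the space of bounded linear operators on $\mathcal{X}$, and $\mathcal{X}^*$ is the dual space. Given an increasing sequence $\{m_n\}_{n\in\mathbb{N}}$ of positive integers, a BK-space $\mathcal{X}_d$ here is a Banach space whose elements are scalar families $\{c_{n,i}\}_{n\in\mathbb{N},\,1\le i\le m_n}$ (with coordinatewise linear operations) and on which every coordinate functional is continuous. Definition. For any $K\in L(\mathcal{X})$, $\{x_n\}\subset\mathcal{X}$, and $\{h_{n,i}\}_{n\in\mathbb{N},\,1\le i\le m_n}\subset\mathcal{X}^*$, the pair $(\{x_n\},\{h_{n,i}\})$ is an approximative $K$-atomic decomposition for $\mathcal{X}$ with respect to $\mathcal{X}_d$ if: (a) $\{h_{n,i}(x)\}_{n\in\mathbb{N},1\le i\le m_n}\in\mathcal{X}_d$ for all $x\in\mathcal{X}$;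 (b) there exist constants $A$ and $B$ with $0<A\le B<\infty$ such that $A\|K(x)\|_{\mathcal{X}}\le \|\{h_{n,i}(x)\}\|_{\mathcal{X}_d}\le B\|x\|_{\mathcal{X}}$ for all $x\in\mathcal{X}$; (c) for all $x\in\mathcal{X}$ the limit $\lim_{n\to\infty}\sum_{i=1}^{m_n}h_{n,i}(x)x_i$ exists in $\mathcal{X}$ and equals $K(x)$. The constants $A$ and $B$ in (b) are called lower and upper bounds of the approximative $K$-atomic decomposition.
   Formalization: The bounds A/‖T‖ and B are shown to be positive and to satisfy the inequalities of (b), but A/‖T‖ ≤ B is not claimed, since it can fail (X = ℝ, K = id, A = B = 1, T = 1/2); some ordered pair of bounds for TK is shown to exist. *)

theory Defs
  imports "HOL-Analysis.Analysis" "HOL-Library.Function_Algebras"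
begin

(* A normed space over a scalar field 'k. By the Gelfand-Mazur theorem the types of class
   real_normed_field are, up to isometric isomorphism, exactly the real and the complex numbers,
   so 'k :: real_normed_field renders "the scalars are R or C". The type class structure of 'a
   supplies the norm, its topology and the underlying real vector space; the locale adds the
   action of 'k. A Banach space over 'k is such an 'a of class banach. *)
locale normed_space_over = vector_space smul
  for smul :: "'k::real_normed_field \<Rightarrow> 'a::real_normed_vector \<Rightarrow> 'a" +
  assumes norm_scale: "norm (smul c x) = norm c * norm x"
    and scale_of_real: "smul (of_real r) x = r *\<^sub>R x"

lemma normed_space_over_real: "normed_space_over (scaleR :: real \<Rightarrow> 'a::real_normed_vector \<Rightarrow> 'a)"
  by unfold_locales (auto simp: algebra_simps)

lemma normed_space_over_complex: "normed_space_over ((*) :: complex \<Rightarrow> complex \<Rightarrow> complex)"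
  by unfold_locales (auto simp: algebra_simps norm_mult scaleR_conv_of_real)

(* The library type 'a \<Rightarrow>\<^sub>L 'b only enforces real linearity. Its norm is the usual operator norm. *)
definition operators ::
  "('k::real_normed_field \<Rightarrow> 'a::real_normed_vector \<Rightarrow> 'a) \<Rightarrow> ('a \<Rightarrow>\<^sub>L 'a) set" where
  "operators smul = {T. Vector_Spaces.linear smul smul (blinfun_apply T)}"

definition dual_space ::
  "('k::real_normed_field \<Rightarrow> 'a::real_normed_vector \<Rightarrow> 'a) \<Rightarrow> ('a \<Rightarrow>\<^sub>L 'k) set" where
  "dual_space smul = {f. Vector_Spaces.linear smul (*) (blinfun_apply f)}"

(* Index pairs (n, i); as in the source, the natural numbers start at 1. *)
definition index_pairs :: "(nat \<Rightarrow> nat) \<Rightarrow> (nat \<times> nat) set" where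
  "index_pairs m = {(n, i). 1 \<le> n \<and> 1 \<le> i \<and> i \<le> m n}"

(* A family indexed by J is encoded as a total function that vanishes outside J.
   The space consists of a carrier S of such families and a norm N, relevant on S only. *)
locale normed_family_space =
  fixes J :: "'j set" and S :: "('j \<Rightarrow> 'k::real_normed_field) set" and N :: "('j \<Rightarrow> 'k) \<Rightarrow> real"
  assumes outside: "\<lbrakk>c \<in> S; j \<notin> J\<rbrakk> \<Longrightarrow> c j = 0"
    and zero_mem: "0 \<in> S"
    and add_mem: "\<lbrakk>c \<in> S; d \<in> S\<rbrakk> \<Longrightarrow> c + d \<in> S"
    and scale_mem: "c \<in> S \<Longrightarrow> (\<lambda>j. a * c j) \<in> S"
    and N_nonneg: "c \<in> S \<Longrightarrow> 0 \<le> N c"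
    and N_eq_0: "c \<in> S \<Longrightarrow> N c = 0 \<longleftrightarrow> c = 0"
    and N_scale: "c \<in> S \<Longrightarrow> N (\<lambda>j. a * c j) = norm a * N c"
    and N_triangle: "\<lbrakk>c \<in> S; d \<in> S\<rbrakk> \<Longrightarrow> N (c + d) \<le> N c + N d"

(* The value 0 off S only serves the library locale Metric_space, which wants distances to be
   nonnegative and symmetric on the whole type. *)
definition family_dist ::
  "('j \<Rightarrow> 'k::real_normed_field) set \<Rightarrow> (('j \<Rightarrow> 'k) \<Rightarrow> real) \<Rightarrow> ('j \<Rightarrow> 'k) \<Rightarrow> ('j \<Rightarrow> 'k) \<Rightarrow> real" where
  "family_dist S N c d = (if c \<in> S \<and> d \<in> S then N (c - d) else 0)"

context normed_family_space
begin

lemma uminus_mem: "c \<in> S \<Longrightarrow> - c \<in> S"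
  using scale_mem[of c "-1"] by (simp add: fun_Compl_def)

lemma diff_mem: "\<lbrakk>c \<in> S; d \<in> S\<rbrakk> \<Longrightarrow> c - d \<in> S"
  using add_mem[of c "- d"] uminus_mem[of d] by simp

lemma N_minus: "c \<in> S \<Longrightarrow> N (- c) = N c"
  using N_scale[of c "-1"] by (simp add: fun_Compl_def)

sublocale Metric_space S "family_dist S N"
proof
  show "0 \<le> family_dist S N c d" for c d
    by (simp add: family_dist_def N_nonneg diff_mem)
  show "family_dist S N c d = family_dist S N d c" for c d
    using N_minus[of "c - d"] by (auto simp: family_dist_def diff_mem)
  show "family_dist S N c d = 0 \<longleftrightarrow> c = d" if "c \<in> S" "d \<in> S" for c d
    using that by (simp add: family_dist_def N_eq_0 diff_mem)
  show "family_dist S N c e \<le> family_dist S N c d + family_dist S N d e"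
    if "c \<in> S" "d \<in> S" "e \<in> S" for c d e
    using that N_triangle[of "c - d" "d - e"] by (simp add: family_dist_def diff_mem)
qed

end

locale BK_space = normed_family_space J S N
  for J :: "'j set" and S :: "('j \<Rightarrow> 'k::real_normed_field) set" and N :: "('j \<Rightarrow> 'k) \<Rightarrow> real" +
  assumes complete: "mcomplete"
    and coordinate_continuous: "j \<in> J \<Longrightarrow> continuous_map mtopology euclidean (\<lambda>c. c j)"

definition coefficients ::
  "(nat \<Rightarrow> nat) \<Rightarrow> (nat \<Rightarrow> nat \<Rightarrow> 'a::real_normed_vector \<Rightarrow>\<^sub>L 'k::real_normed_field) \<Rightarrow> 'a \<Rightarrow> nat \<times> nat \<Rightarrow> 'k" where
  "coefficients m h x = (\<lambda>(n, i). if (n, i) \<in> index_pairs m then h n i x else 0)"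

(* The order A \<le> B is deliberately not part of "A and B are bounds": replacing K by T K turns
   bounds A, B into bounds A / norm T, B, and A / norm T may exceed B (for instance K = id on R,
   A = B = 1, T = id / 2). It is imposed on the bounds whose existence is demanded in
   approximative_decomposition. *)
definition decomposition_bounds ::
  "(nat \<Rightarrow> nat) \<Rightarrow> ((nat \<times> nat \<Rightarrow> 'k::real_normed_field) \<Rightarrow> real) \<Rightarrow>
    ('a::real_normed_vector \<Rightarrow>\<^sub>L 'a) \<Rightarrow> (nat \<Rightarrow> nat \<Rightarrow> 'a \<Rightarrow>\<^sub>L 'k) \<Rightarrow> real \<Rightarrow> real \<Rightarrow> bool" where
  "decomposition_bounds m N K h A B \<longleftrightarrow> 0 < A \<and> 0 < B \<and>
    (\<forall>x. A * norm (K x) \<le> N (coefficients m h x) \<and> N (coefficients m h x) \<le> B * norm x)"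

definition approximative_decomposition ::
  "('k::real_normed_field \<Rightarrow> 'a::real_normed_vector \<Rightarrow> 'a) \<Rightarrow>
    (nat \<Rightarrow> nat) \<Rightarrow> (nat \<times> nat \<Rightarrow> 'k) set \<Rightarrow> ((nat \<times> nat \<Rightarrow> 'k) \<Rightarrow> real) \<Rightarrow>
    ('a \<Rightarrow>\<^sub>L 'a) \<Rightarrow> (nat \<Rightarrow> 'a) \<Rightarrow> (nat \<Rightarrow> nat \<Rightarrow> 'a \<Rightarrow>\<^sub>L 'k) \<Rightarrow> bool" where
  "approximative_decomposition smul m S N K u h \<longleftrightarrow>
    K \<in> operators smul \<and>
    (\<forall>(n, i) \<in> index_pairs m. h n i \<in> dual_space smul) \<and>
    (\<forall>x. coefficients m h x \<in> S) \<and>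
    (\<exists>A B. A \<le> B \<and> decomposition_bounds m N K h A B) \<and>
    (\<forall>x. (\<lambda>n. \<Sum>i = 1..m n. smul (h n i x) (u i)) \<longlonglongrightarrow> K x)"

end

theory Submission
  imports Defs
begin

text \<open>
  The coefficient families, and with them membership in the sequence space and the upper bound,
  are untouched when \<open>K\<close> is replaced by \<open>TK\<close>. The lower bound follows from
  \<open>\<parallel>TKx\<parallel> \<le> \<parallel>T\<parallel> \<parallel>Kx\<parallel>\<close> (\<open>decomposition_bounds_compose\<close>), and applying the linear and
  continuous \<open>T\<close> to the partial sums carries their convergence to \<open>Kx\<close> over to convergence to
  \<open>TKx\<close> (\<open>reconstruction_compose\<close>).

  The quotient \<open>A / \<parallel>T\<parallel>\<close> may exceed \<open>B\<close>, whereas a decomposition demands some pair of bounds in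
  increasing order. Since a lower bound may always be decreased, \<open>min (A / \<parallel>T\<parallel>) B\<close> and \<open>B\<close> are
  such a pair.
\<close>

lemma operators_compose:
  assumes "T \<in> operators smul" and "K \<in> operators smul"
  shows "T o\<^sub>L K \<in> operators smul"
proof -
  have "blinfun_apply (T o\<^sub>L K) = blinfun_apply T \<circ> blinfun_apply K"
    by (simp add: fun_eq_iff)
  then show ?thesis
    using assms by (simp add: operators_def Vector_Spaces.linear_compose)
qed

lemma decomposition_bounds_decrease_lower:
  assumes "decomposition_bounds m N K h A B" and "0 < A'" and "A' \<le> A"
  shows "decomposition_bounds m N K h A' B"
proof -
  have "A' * norm (K x) \<le> A * norm (K x)" for x
    using assms(3) by (rule mult_right_mono) simp
  then show ?thesis
    using assms(1,2) unfolding decomposition_bounds_def by (meson order_trans)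
qed

lemma decomposition_bounds_compose:
  assumes bounds: "decomposition_bounds m N K h A B" and "T \<noteq> 0"
  shows "decomposition_bounds m N (T o\<^sub>L K) h (A / norm T) B"
proof -
  have "0 < norm T"
    using \<open>T \<noteq> 0\<close> by simp
  have "0 < A"
    using bounds by (simp add: decomposition_bounds_def)
  have "A / norm T * norm ((T o\<^sub>L K) x) \<le> A * norm (K x)" for x
  proof -
    have "A / norm T * norm (T (K x)) \<le> A / norm T * (norm T * norm (K x))"
      using \<open>0 < A\<close> by (intro mult_left_mono norm_blinfun) auto
    then show ?thesis
      using \<open>0 < norm T\<close> by simp
  qed
  then show ?thesis
    using bounds \<open>0 < norm T\<close> unfolding decomposition_bounds_def
    by (meson divide_pos_pos order_trans)
qed

lemma reconstruction_compose:
  assumes "T \<in> operators smul"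
    and "(\<lambda>n. \<Sum>i = 1..m n. smul (c n i) (u i)) \<longlonglongrightarrow> y"
  shows "(\<lambda>n. \<Sum>i = 1..m n. smul (c n i) (T (u i))) \<longlonglongrightarrow> T y"
proof -
  interpret T: Vector_Spaces.linear smul smul "blinfun_apply T"
    using assms(1) by (simp add: operators_def)
  have "(\<lambda>n. T (\<Sum>i = 1..m n. smul (c n i) (u i))) \<longlonglongrightarrow> T y"
    using assms(2) by (intro tendsto_intros)
  then show ?thesis
    by (simp add: T.sum T.scale)
qed

theorem theorem2p8:
  fixes smul :: "'k::real_normed_field \<Rightarrow> 'a::banach \<Rightarrow> 'a"
    and K T :: "'a \<Rightarrow>\<^sub>L 'a"
    and m :: "nat \<Rightarrow> nat"
    and u :: "nat \<Rightarrow> 'a"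
    and h :: "nat \<Rightarrow> nat \<Rightarrow> 'a \<Rightarrow>\<^sub>L 'k"
    and S :: "(nat \<times> nat \<Rightarrow> 'k) set"
    and N :: "(nat \<times> nat \<Rightarrow> 'k) \<Rightarrow> real"
    and A B :: real
  assumes "normed_space_over smul"
    and "separable_space (euclidean :: 'a topology)"
    and "K \<in> operators smul"
    and "closed (range (blinfun_apply K))"
    and "\<forall>n\<ge>1. 1 \<le> m n"
    and "mono_on {1..} m"
    and "BK_space (index_pairs m) S N"
    and "approximative_decomposition smul m S N K u h"
    and "decomposition_bounds m N K h A B"
    and "A \<le> B"
    and "T \<in> operators smul"
    and "T \<noteq> 0"
  shows "approximative_decomposition smul m S N (T o\<^sub>L K) (\<lambda>n. T (u n)) h \<and>
    decomposition_bounds m N (T o\<^sub>L K) h (A / norm T) B"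
proof
  show bounds: "decomposition_bounds m N (T o\<^sub>L K) h (A / norm T) B"
    using assms by (intro decomposition_bounds_compose)
  have "0 < min (A / norm T) B"
    using bounds by (simp add: decomposition_bounds_def)
  then have "decomposition_bounds m N (T o\<^sub>L K) h (min (A / norm T) B) B"
    by (rule decomposition_bounds_decrease_lower[OF bounds]) simp
  then have ordered: "\<exists>A B. A \<le> B \<and> decomposition_bounds m N (T o\<^sub>L K) h A B"
    by (meson min.cobounded2)
  have "(\<lambda>n. \<Sum>i = 1..m n. smul (h n i x) (T (u i))) \<longlonglongrightarrow> (T o\<^sub>L K) x" for x
    using assms(8,11) reconstruction_compose[of T smul "\<lambda>n i. h n i x" u m "K x"]
    by (simp add: approximative_decomposition_def)
  moreover have "T o\<^sub>L K \<in> operators smul"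
    using assms by (intro operators_compose)
  ultimately show "approximative_decomposition smul m S N (T o\<^sub>L K) (\<lambda>n. T (u n)) h"
    using assms(8) ordered by (simp add: approximative_decomposition_def)
qed

end
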